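(* Let $n\ge1$ and let $\mathcal{X}$ be a collection of arcs of the regular $2n$-gon which is invariant under rotation by $180$ degrees. Then the following conditions are equivalent: (a) $\mathcal{X}=\mathrm{nc}\,\mathrm{nc}\,\mathcal{X}$. (b) $\mathcal{X}$ is a Ptolemy diagram of type $D$.
   Context: **Arcs.** Vertices of the regular $2n$-gon $P$ are labelled counterclockwise $0,\dots,2n-1$, modulo $2n$. An arc is a set $\{i,j\}$ of two distinct non-neighbouring vertices; arcs $\{i,i+n\}$ are called diameters, and each occurs in two copies, green $\{i,i+n\}_g$ and red $\{i,i+n\}_r$. For $n=1$ the arcs of the $2$-gon are by convention exactly the two diameters $\{0,1\}_g,\{0,1\}_r$. Rotation by $180$ degrees sends $\{i,j\}$ to $\{i+n,j+n\}$ and fixes each coloured diameter. **Crossing.** Two arcs $\{i,j\}$, $\{k,\ell\}$, at most one of which is a diameter (of any colour), cross iff $i,j,k,\ell$ are distinct and come in the order $i,k,j,\ell$ when moving around $P$ in one direction or the other. Two diameters cross iff they have different colours and different endpoints. **The operator nc.** For a set $\mathcal{X}$ of arcs of $P$, $\mathrm{nc}\,\mathcal{X}$ is the set of all arcs of $P$ (including coloured diameters) which cross no arc in $\mathcal{X}$. **Ptolemy diagram of type $D$.** For $n>1$: a collection $\mathcal{X}$ of arcs of the $2n$-gon, invariant under rotation by $180$ degrees, such that for all crossing arcs $\alpha=\{i,j\}$ and $\beta=\{k,\ell\}$ in $\mathcal{X}$: (Pt1) If $\alpha,\beta$ are not diameters, then those of $\{i,k\},\{i,\ell\},\{j,k\},\{j,\ell\}$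 which are arcs are also in $\mathcal{X}$; in particular, if one of these is a diameter, both its green and its red copy are in $\mathcal{X}$. (Pt2) If both are diameters ($j=i+n$, $\ell=k+n$), then those of $\{i,k\},\{i,k+n\},\{i+n,k\},\{i+n,k+n\}$ which are arcs are also in $\mathcal{X}$. (Pt3) If $\alpha$ is a diameter and $\beta$ is not, then those of $\{i,k\},\{i,\ell\},\{j,k\},\{j,\ell\}$ which are arcs and do not cross $\{k+n,\ell+n\}$ are also in $\mathcal{X}$; additionally the diameters $\{k,k+n\}$ and $\{\ell,\ell+n\}$ of the same colour as $\alpha$ are in $\mathcal{X}$. For $n=1$ there is by convention exactly one Ptolemy diagram of type $D$ of the $2$-gon, consisting of the two coloured diameters. *)

theory Defs
  imports Main
begin

datatype colour = Green | Red

text \<open>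
  The vertices of the regular \<open>2n\<close>-gon are \<open>0, \<dots>, 2n - 1\<close>, in counterclockwise order.
  An arc is given by its set of endpoints; a diameter carries its colour in addition.
\<close>

datatype arc = Chord (endpoints: "nat set") | Diameter colour (endpoints: "nat set")

definition opposite :: "nat \<Rightarrow> nat \<Rightarrow> nat" where
  "opposite n i = (i + n) mod (2 * n)"

definition neighbours :: "nat \<Rightarrow> nat \<Rightarrow> nat \<Rightarrow> bool" where
  "neighbours n i j \<longleftrightarrow> j = (i + 1) mod (2 * n) \<or> i = (j + 1) mod (2 * n)"

definition diameter :: "nat \<Rightarrow> colour \<Rightarrow> nat \<Rightarrow> arc" where
  "diameter n c i = Diameter c {i, opposite n i}"

text \<open>
  For \<open>n > 1\<close> opposite vertices are never neighbours. For \<open>n = 1\<close> they are, and there are no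
  chords; keeping both diameters is then exactly the convention for the \<open>2\<close>-gon.
\<close>

definition arcs :: "nat \<Rightarrow> arc set" where
  "arcs n =
     {Chord {i, j} | i j. i < 2 * n \<and> j < 2 * n \<and> i \<noteq> j \<and> \<not> neighbours n i j \<and> j \<noteq> opposite n i}
     \<union> {diameter n c i | c i. i < 2 * n}"

text \<open>
  All arcs with endpoints \<open>i\<close> and \<open>j\<close>: none if \<open>{i, j}\<close> is not an arc, and both coloured copies
  if \<open>{i, j}\<close> is a diameter.
\<close>

definition arcs_between :: "nat \<Rightarrow> nat \<Rightarrow> nat \<Rightarrow> arc set" where
  "arcs_between n i j = {a \<in> arcs n. endpoints a = {i, j}}"

definition rot180 :: "nat \<Rightarrow> arc \<Rightarrow> arc" where
  "rot180 n a = (case a of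
       Chord A \<Rightarrow> Chord (opposite n ` A)
     | Diameter c A \<Rightarrow> Diameter c (opposite n ` A))"

text \<open>
  Four distinct vertices are met in the order \<open>i, k, j, l\<close> when moving counterclockwise iff
  some cyclic shift of this sequence is increasing.
\<close>

definition ccw_order :: "nat \<Rightarrow> nat \<Rightarrow> nat \<Rightarrow> nat \<Rightarrow> bool" where
  "ccw_order i k j l \<longleftrightarrow>
     (i < k \<and> k < j \<and> j < l) \<or> (k < j \<and> j < l \<and> l < i) \<or>
     (j < l \<and> l < i \<and> i < k) \<or> (l < i \<and> i < k \<and> k < j)"

text \<open>The clockwise order \<open>i, k, j, l\<close> is the counterclockwise order \<open>l, j, k, i\<close>.\<close>

definition separated :: "nat set \<Rightarrow> nat set \<Rightarrow> bool" where
  "separated A B \<longleftrightarrow>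
     (\<exists>i j k l. A = {i, j} \<and> B = {k, l} \<and> (ccw_order i k j l \<or> ccw_order l j k i))"

fun crosses :: "arc \<Rightarrow> arc \<Rightarrow> bool" where
  "crosses (Diameter c A) (Diameter d B) \<longleftrightarrow> c \<noteq> d \<and> A \<noteq> B"
| "crosses a b \<longleftrightarrow> separated (endpoints a) (endpoints b)"

definition nc :: "nat \<Rightarrow> arc set \<Rightarrow> arc set" where
  "nc n X = {a \<in> arcs n. \<forall>b \<in> X. \<not> crosses a b}"

definition Pt1 :: "nat \<Rightarrow> arc set \<Rightarrow> bool" where
  "Pt1 n X \<longleftrightarrow> (\<forall>i j k l.
     Chord {i, j} \<in> X \<and> Chord {k, l} \<in> X \<and> crosses (Chord {i, j}) (Chord {k, l}) \<longrightarrow>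
       arcs_between n i k \<union> arcs_between n i l \<union> arcs_between n j k \<union> arcs_between n j l \<subseteq> X)"

definition Pt2 :: "nat \<Rightarrow> arc set \<Rightarrow> bool" where
  "Pt2 n X \<longleftrightarrow> (\<forall>c d i k. let j = opposite n i; l = opposite n k in
     diameter n c i \<in> X \<and> diameter n d k \<in> X \<and> crosses (diameter n c i) (diameter n d k) \<longrightarrow>
       arcs_between n i k \<union> arcs_between n i l \<union> arcs_between n j k \<union> arcs_between n j l \<subseteq> X)"

definition Pt3 :: "nat \<Rightarrow> arc set \<Rightarrow> bool" where
  "Pt3 n X \<longleftrightarrow> (\<forall>c i k l. let j = opposite n i in
     diameter n c i \<in> X \<and> Chord {k, l} \<in> X \<and> crosses (diameter n c i) (Chord {k, l}) \<longrightarrow>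
       {a \<in> arcs_between n i k \<union> arcs_between n i l \<union> arcs_between n j k \<union> arcs_between n j l.
          \<not> crosses a (Chord {opposite n k, opposite n l})} \<subseteq> X \<and>
       diameter n c k \<in> X \<and> diameter n c l \<in> X)"

definition ptolemy_diagram_D :: "nat \<Rightarrow> arc set \<Rightarrow> bool" where
  "ptolemy_diagram_D n X \<longleftrightarrow>
     (if n = 1 then X = {Diameter Green {0, 1}, Diameter Red {0, 1}}
      else X \<subseteq> arcs n \<and> rot180 n ` X = X \<and> Pt1 n X \<and> Pt2 n X \<and> Pt3 n X)"

end

theory Submission
  imports Defs
begin

text \<open>
  For (a) \<open>\<Longrightarrow>\<close> (b), an arc crossing one of the arcs demanded by a Ptolemy condition already
  crosses one of the two given arcs or the rotation of one of them.

  For (b) \<open>\<Longrightarrow>\<close> (a), let \<open>a \<notin> X\<close> be an arc with endpoint \<open>u\<close>; one needs an arc \<open>b \<in> nc X\<close> crossing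
  \<open>a\<close>. Let \<open>s < t\<close> be vertices joined to \<open>u\<close> by a boundary edge or by arcs of \<open>X\<close> (in both colours
  if it is a diameter), consecutive among such vertices around the other endpoint of \<open>a\<close>. An arc of
  \<open>X\<close> crossing \<open>{s, t}\<close> ends at \<open>u\<close> or crosses \<open>{u, s}\<close> or \<open>{u, t}\<close>, and the Ptolemy conditions
  then join \<open>u\<close> to a vertex strictly between \<open>s\<close> and \<open>t\<close> or put a diameter at \<open>u\<close> into \<open>X\<close>. So
  \<open>b = {s, t}\<close> works, coloured differently from \<open>a\<close> if both are diameters.
  The exception is when \<open>{u, u + n}\<close> would lie strictly between and \<open>X\<close> contains its copy of exactly
  one colour \<open>c\<close>; then \<open>b\<close> is the diameter at \<open>s\<close> of colour \<open>c\<close>.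
\<close>

text \<open>
  Vertices are represented by arbitrary natural numbers modulo \<open>2n\<close>, so that cyclic order
  becomes linear order inside a window \<open>x, \<dots>, x + 2n - 1\<close>. The predicate \<open>side\<close> also holds
  for boundary edges, and for a diameter it demands both colours.
\<close>

definition chord :: "nat \<Rightarrow> nat \<Rightarrow> nat \<Rightarrow> arc" where
  "chord n x y = Chord {x mod (2 * n), y mod (2 * n)}"

definition diam :: "nat \<Rightarrow> colour \<Rightarrow> nat \<Rightarrow> arc" where
  "diam n c x = Diameter c {x mod (2 * n), (x + n) mod (2 * n)}"

definition side :: "nat \<Rightarrow> arc set \<Rightarrow> nat \<Rightarrow> nat \<Rightarrow> bool" where
  "side n X x y \<longleftrightarrow> arcs_between n (x mod (2 * n)) (y mod (2 * n)) \<subseteq> X"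

section \<open>Arcs with endpoints taken modulo \<open>2 * n\<close>\<close>

lemma endpoints_chord [simp]: "endpoints (chord n x y) = {x mod (2 * n), y mod (2 * n)}"
  by (simp add: chord_def)

lemma endpoints_diam [simp]: "endpoints (diam n c x) = {x mod (2 * n), (x + n) mod (2 * n)}"
  by (simp add: diam_def)

lemma opposite_mod: "opposite n (x mod (2 * n)) = (x + n) mod (2 * n)"
  by (simp add: opposite_def mod_simps)

lemma diameter_mod: "diameter n c (x mod (2 * n)) = diam n c x"
  by (simp add: diameter_def diam_def opposite_mod)

lemma diameter_eq_diam: "i < 2 * n \<Longrightarrow> diameter n c i = diam n c i"
  using diameter_mod[of n c i] by simp

lemma chord_commute: "chord n x y = chord n y x"
  by (simp add: chord_def insert_commute)

lemma chord_shift: "chord n (x + 2 * n) y = chord n x y" "chord n x (y + 2 * n) = chord n x y"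
  by (simp_all add: chord_def)

lemma add_twice_mod: "(x + n + n) mod (2 * n) = x mod (2 * n)" for x n :: nat
  by (metis add.assoc mod_add_self2 mult_2)

lemma diam_shift: "diam n c (x + n) = diam n c x"
  by (simp add: diam_def add_twice_mod insert_commute)

lemma side_commute: "side n X x y = side n X y x"
  by (simp add: side_def arcs_between_def insert_commute)

lemma side_shift: "side n X (x + 2 * n) y = side n X x y" "side n X x (y + 2 * n) = side n X x y"
  by (simp_all add: side_def)

lemma rot180_chord: "rot180 n (chord n x y) = chord n (x + n) (y + n)"
  by (simp add: chord_def rot180_def opposite_mod)

lemma rot180_diam: "rot180 n (diam n c x) = diam n c x"
  by (simp add: diam_def rot180_def opposite_mod add_twice_mod insert_commute)

section \<open>Cyclic order as linear order inside a window\<close>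

text \<open>Here \<open>h\<close> is the largest multiple of \<open>m\<close> not exceeding
  \<open>x\<close>. Beyond it, at most the multiple \<open>h + m\<close> falls into the window, so
  reduction subtracts one of these two. This opens statements about residues to linear
  arithmetic.\<close>

lemma mod_window:
  fixes x m :: nat
  assumes "0 < m"
  obtains h where "h \<le> x" "x < h + m"
    "\<And>a. x \<le> a \<Longrightarrow> a < x + m \<Longrightarrow> a mod m = (if a < h + m then a - h else a - h - m)"
proof
  let ?h = "m * (x div m)"
  show 1: "?h \<le> x" by (rule times_div_less_eq_dividend)
  show 2: "x < ?h + m"
    using assms by (metis add.commute add_less_cancel_right mod_less_divisor mult_div_mod_eq)
  show "a mod m = (if a < ?h + m then a - ?h else a - ?h - m)" if "x \<le> a" "a < x + m" for a
  proof (cases "a < ?h + m")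
    case True
    have "a = (a - ?h) + m * (x div m)" using le_trans[OF 1 that(1)] by (rule le_add_diff_inverse2[symmetric])
    then have "a mod m = (a - ?h) mod m" by (metis mod_mult_self2)
    then show ?thesis using True that 1 assms by (simp add: less_diff_conv2)
  next
    case False
    then have "a = (a - ?h - m) + m * (Suc (x div m))" using that 1 by (simp add: not_less)
    then have "a mod m = (a - ?h - m) mod m" by (metis mod_mult_self2)
    also have "\<dots> = a - ?h - m" using False that 2 by (intro mod_less) linarith
    finally show ?thesis using False by simp
  qed
qed

lemma mod_eq_window:
  fixes x m :: nat
  assumes "x \<le> a" "a < x + m" "x \<le> b" "b < x + m"
  shows "a mod m = b mod m \<longleftrightarrow> a = b"
proof -
  have m: "0 < m" using assms by simp
  obtain h where h: "h \<le> x" "x < h + m"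
    "\<And>a. x \<le> a \<Longrightarrow> a < x + m \<Longrightarrow> a mod m = (if a < h + m then a - h else a - h - m)"
    using mod_window[OF m] by blast
  show ?thesis unfolding h(3)[OF assms(1,2)] h(3)[OF assms(3,4)]
    using assms h(1,2) by auto
qed

lemma mod_repr:
  fixes x m r :: nat
  assumes "r < m"
  obtains a where "x \<le> a" "a < x + m" "a mod m = r"
proof -
  have m: "0 < m" using assms by simp
  obtain h where h: "h \<le> x" "x < h + m"
    "\<And>a. x \<le> a \<Longrightarrow> a < x + m \<Longrightarrow> a mod m = (if a < h + m then a - h else a - h - m)"
    using mod_window[OF m] by blast
  show ?thesis
  proof (cases "x \<le> r + h")
    case True
    with h(1,2) assms show ?thesis by (intro that[of "r + h"]) (auto simp: h(3) simp del: mod_add_self2)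
  next
    case False
    with h(1,2) assms show ?thesis by (intro that[of "r + h + m"]) (auto simp: h(3) simp del: mod_add_self2)
  qed
qed

text \<open>Reduction modulo \<open>m\<close> only rotates the window, which preserves the cyclic
  order of any three points. The cyclic order of four points is the conjunction of the cyclic orders
  of two triples, and for triples a split into eight linear cases suffices.\<close>

lemma ccw_order_window:
  assumes "x \<le> a" "a < x + m" "x \<le> b" "b < x + m" "x \<le> c" "c < x + m" "x \<le> d" "d < x + m"
  shows "ccw_order (a mod m) (b mod m) (c mod m) (d mod m) \<longleftrightarrow> ccw_order a b c d"
proof -
  define cyc :: "nat \<Rightarrow> nat \<Rightarrow> nat \<Rightarrow> bool"
    where "cyc a b c \<longleftrightarrow> a < b \<and> b < c \<or> b < c \<and> c < a \<or> c < a \<and> a < b" for a b c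
  have ccw: "ccw_order a b c d \<longleftrightarrow> cyc a b c \<and> cyc a c d" for a b c d
    unfolding ccw_order_def cyc_def by auto
  have m: "0 < m" using assms by simp
  obtain h where h: "h \<le> x" "x < h + m"
    "\<And>a. x \<le> a \<Longrightarrow> a < x + m \<Longrightarrow> a mod m = (if a < h + m then a - h else a - h - m)"
    using mod_window[OF m] by blast
  have "cyc (a mod m) (b mod m) (c mod m) \<longleftrightarrow> cyc a b c"
    if "x \<le> a" "a < x + m" "x \<le> b" "b < x + m" "x \<le> c" "c < x + m" for a b c
    unfolding h(3)[OF that(1,2)] h(3)[OF that(3,4)] h(3)[OF that(5,6)] cyc_def
    using that h(1,2)
    by (cases "a < h + m"; cases "b < h + m"; cases "c < h + m") (simp; linarith)+
  then show ?thesis unfolding ccw using assms by simp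
qed

text \<open>Swapping the names within one pair turns a clockwise alternation into a counterclockwise
  one, so two counterclockwise patterns cover all labellings allowed by the definition.\<close>

lemma separated_iff: "separated {a, b} {c, d} \<longleftrightarrow> ccw_order a c b d \<or> ccw_order a d b c"
proof
  assume "separated {a, b} {c, d}"
  then obtain i j k l where e: "{a, b} = {i, j}" "{c, d} = {k, l}"
    and o: "ccw_order i k j l \<or> ccw_order l j k i"
    unfolding separated_def by blast
  from e show "ccw_order a c b d \<or> ccw_order a d b c"
    using o unfolding doubleton_eq_iff by (auto simp: ccw_order_def)
next
  assume "ccw_order a c b d \<or> ccw_order a d b c"
  then show "separated {a, b} {c, d}"
  proof
    assume "ccw_order a c b d"
    then show ?thesis unfolding separated_def by blast
  next
    assume "ccw_order a d b c"
    then have "{a, b} = {a, b} \<and> {c, d} = {d, c} \<and> (ccw_order a d b c \<or> ccw_order c b d a)"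
      by auto
    then show ?thesis unfolding separated_def by blast
  qed
qed

lemma separated_window:
  assumes "x < y" "y < x + 2 * n" "x \<le> p" "p < x + 2 * n" "x \<le> q" "q < x + 2 * n"
  shows "separated {x mod (2 * n), y mod (2 * n)} {p mod (2 * n), q mod (2 * n)} \<longleftrightarrow>
    x < p \<and> p < y \<and> y < q \<or> x < q \<and> q < y \<and> y < p"
proof -
  have x: "x \<le> x" "x < x + 2 * n" "x \<le> y" using assms by simp_all
  show ?thesis
    unfolding separated_iff ccw_order_window[OF x(1,2) assms(3,4) x(3) assms(2,5,6)]
      ccw_order_window[OF x(1,2) assms(5,6) x(3) assms(2,3,4)]
    using assms by (auto simp: ccw_order_def)
qed

lemma separatedI:
  assumes "x < p" "p < y" "y < q" "q < x + 2 * n"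
  shows "separated {x mod (2 * n), y mod (2 * n)} {p mod (2 * n), q mod (2 * n)}"
  using assms by (subst separated_window) auto

lemma separated_commute: "separated A B \<longleftrightarrow> separated B A"
proof -
  have "separated A B \<Longrightarrow> separated B A" for A B
  proof -
    assume "separated A B"
    then obtain i j k l where "A = {i, j}" "B = {k, l}" and "separated {i, j} {k, l}"
      unfolding separated_def by blast
    then show ?thesis unfolding separated_iff by (auto simp: separated_iff ccw_order_def)
  qed
  then show ?thesis by blast
qed

lemma crosses_commute: "crosses a b \<longleftrightarrow> crosses b a"
  by (cases a; cases b) (auto simp: separated_commute)

lemma crosses_chord [simp]:
  "crosses (chord n x y) b \<longleftrightarrow> separated {x mod (2 * n), y mod (2 * n)} (endpoints b)"
  "crosses a (Chord B) \<longleftrightarrow> separated (endpoints a) B"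
  by (cases b; simp add: chord_def) (cases a; simp)

section \<open>Arcs and boundary edges in a window\<close>

lemma neighbours_window:
  assumes "0 < n" "x < y" "y < x + 2 * n"
  shows "neighbours n (x mod (2 * n)) (y mod (2 * n)) \<longleftrightarrow> y = x + 1 \<or> y + 1 = x + 2 * n"
proof -
  have "y mod (2 * n) = (x mod (2 * n) + 1) mod (2 * n) \<longleftrightarrow> y mod (2 * n) = (x + 1) mod (2 * n)"
    by (simp add: mod_simps)
  also have "\<dots> \<longleftrightarrow> y = x + 1"
    using assms by (intro mod_eq_window[of x]) auto
  finally have 1: "y mod (2 * n) = (x mod (2 * n) + 1) mod (2 * n) \<longleftrightarrow> y = x + 1" .
  \<comment> \<open>Adding \<open>2 * n\<close> to \<open>x\<close> places both vertices in the
    window that starts at \<open>x + 1\<close>, where residues determine representatives.\<close>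
  have "x mod (2 * n) = (y mod (2 * n) + 1) mod (2 * n) \<longleftrightarrow>
      (x + 2 * n) mod (2 * n) = (y + 1) mod (2 * n)"
    by (simp add: mod_simps)
  also have "\<dots> \<longleftrightarrow> x + 2 * n = y + 1"
    using assms by (intro mod_eq_window[of "x + 1"]) auto
  finally show ?thesis using 1 unfolding neighbours_def by auto
qed

lemma opposite_window:
  assumes "x < y" "y < x + 2 * n"
  shows "y mod (2 * n) = opposite n (x mod (2 * n)) \<longleftrightarrow> y = x + n"
  unfolding opposite_mod using assms by (intro mod_eq_window[of x]) auto

lemma diam_in_arcs: "0 < n \<Longrightarrow> diam n c x \<in> arcs n"
  unfolding arcs_def diameter_mod[symmetric] by (auto intro!: exI[of _ "x mod (2 * n)"])

lemma chord_in_arcs: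
  assumes "x + 1 < y" "y + 1 < x + 2 * n" "y \<noteq> x + n"
  shows "chord n x y \<in> arcs n"
proof -
  have n: "0 < n" using assms by simp
  have "x mod (2 * n) \<noteq> y mod (2 * n)"
    using mod_eq_window[of x x "2 * n" y] assms by auto
  then show ?thesis
    unfolding arcs_def chord_def
    using n assms neighbours_window[of n x y] opposite_window[of x y n]
    by (intro UnI1 CollectI exI[of _ "x mod (2 * n)"] exI[of _ "y mod (2 * n)"]) auto
qed

text \<open>Of the two boundary paths joining the ends of a chord, exactly one has fewer than
  \<open>n\<close> edges; the names are chosen so that it runs counterclockwise from
  \<open>x\<close> to \<open>y\<close>.\<close>

lemma arcs_cases:
  assumes "a \<in> arcs n" "0 < n"
  obtains (chord) x y where "a = chord n x y" "x + 1 < y" "y < x + n"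
  | (diam) c x where "a = diam n c x"
proof -
  from assms consider i j where "a = Chord {i, j}" "i < 2 * n" "j < 2 * n" "i \<noteq> j"
      "\<not> neighbours n i j" "j \<noteq> opposite n i"
    | c i where "a = diameter n c i" "i < 2 * n"
    unfolding arcs_def by blast
  then show ?thesis
  proof cases
    case 1
    have main: thesis if a: "a = Chord {i, j}" "i < j" "j < 2 * n" "\<not> neighbours n i j" "j \<noteq> opposite n i"
      for i j
    proof -
      have ij: "i mod (2 * n) = i" "j mod (2 * n) = j" using a by auto
      have "j \<noteq> i + 1" "j + 1 \<noteq> i + 2 * n" "j \<noteq> i + n"
        using neighbours_window[of n i j] opposite_window[of i j n] a assms ij by auto
      show thesis
      proof (cases "j < i + n")
        case True
        then show thesis using a ij \<open>j \<noteq> i + 1\<close>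
          by (intro chord[of i j]) (auto simp: chord_def)
      next
        \<comment> \<open>The short path runs from \<open>j\<close> past the last vertex
          \<open>2 * n - 1\<close> to \<open>i\<close>, so the ends change roles and
          \<open>i\<close> is raised by \<open>2 * n\<close>.\<close>
        case False
        then show thesis using a ij \<open>j + 1 \<noteq> i + 2 * n\<close> \<open>j \<noteq> i + n\<close>
          by (intro chord[of j "i + 2 * n"]) (auto simp: chord_def)
      qed
    qed
    show ?thesis
    proof (cases "i < j")
      case True
      then show ?thesis using main[of i j] 1 by blast
    next
      case False
      have "i \<noteq> opposite n j"
        using opposite_window[of j i n] opposite_window[of i "j + 2 * n" n] 1 False by auto
      then show ?thesis
        using main[of j i] 1 False by (auto simp: insert_commute neighbours_def)
    qed
  next
    case 2
    then show ?thesis using diam diameter_eq_diam by metis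
  qed
qed

section \<open>Lifting crossing arcs into a window\<close>

text \<open>Both ends of \<open>a\<close> have representatives in the window from \<open>x\<close>,
  and alternation puts exactly one of them, called \<open>p\<close>, between \<open>x\<close> and
  \<open>y\<close>. For a diameter the end in the first half of the window is taken as
  \<open>p\<close>, so the other end is \<open>p + n\<close>.\<close>

lemma crossing_lift:
  assumes a: "a \<in> arcs n" and n: "0 < n" and xy: "x < y" "y < x + 2 * n"
    and sep: "separated {x mod (2 * n), y mod (2 * n)} (endpoints a)"
  obtains p q where "x < p" "p < y" "y < q" "q < x + 2 * n"
    "endpoints a = {p mod (2 * n), q mod (2 * n)}"
    "a = chord n p q \<or> q = p + n \<and> (\<exists>c. a = diam n c p)"
proof -
  have lift: "\<exists>p. x \<le> p \<and> p < x + 2 * n \<and> p mod (2 * n) = z mod (2 * n)" for z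
    using mod_repr[of "z mod (2 * n)" "2 * n" x] n by (metis mod_less_divisor mult_pos_pos zero_less_numeral)
  from a n show thesis
  proof (cases rule: arcs_cases)
    case (chord z w)
    obtain p where p: "x \<le> p" "p < x + 2 * n" "p mod (2 * n) = z mod (2 * n)" using lift by blast
    obtain q where q: "x \<le> q" "q < x + 2 * n" "q mod (2 * n) = w mod (2 * n)" using lift by blast
    have apq: "a = chord n p q" using chord p q by (simp add: chord_def)
    then have "x < p \<and> p < y \<and> y < q \<or> x < q \<and> q < y \<and> y < p"
      using sep separated_window[OF xy p(1,2) q(1,2)] by simp
    then show thesis
    proof
      assume "x < p \<and> p < y \<and> y < q"
      then show thesis using apq p q by (intro that[of p q]) auto
    next
      assume "x < q \<and> q < y \<and> y < p"
      then show thesis using apq p q by (intro that[of q p]) (auto simp: chord_commute)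
    qed
  next
    case (diam c z)
    obtain p' where p': "x \<le> p'" "p' < x + 2 * n" "p' mod (2 * n) = z mod (2 * n)" using lift by blast
    have "a = diam n c p'"
      using diam p'(3) by (simp add: diameter_mod[symmetric])
    then obtain p where p: "x \<le> p" "p < x + n" "a = diam n c p"
    proof (cases "p' < x + n")
      case False
      then show ?thesis using \<open>a = diam n c p'\<close> p' diam_shift[of n c "p' - n"]
        by (intro that[of "p' - n"]) auto
    qed (use p' in blast)
    then have "x < p \<and> p < y \<and> y < p + n"
      using sep separated_window[OF xy, of p "p + n"] by auto
    then show thesis using p by (intro that[of p "p + n"]) auto
  qed
qed

lemma crossing_lift_diam:
  assumes "0 < n" "x < y" "y < x + 2 * n"
    and "separated {x mod (2 * n), y mod (2 * n)} (endpoints (diam n c z))"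
  obtains p where "x < p" "p < y" "y < p + n" "p + n < x + 2 * n" "diam n c z = diam n c p"
proof -
  obtain p q where "x < p" "p < y" "y < q" "q < x + 2 * n"
    "diam n c z = chord n p q \<or> q = p + n \<and> (\<exists>d. diam n c z = diam n d p)"
    using crossing_lift[OF diam_in_arcs[OF assms(1)] assms] by metis
  then show thesis by (intro that[of p]) (auto simp: chord_def diam_def)
qed

lemma crosses_diam:
  assumes "x \<le> y" "y < x + n"
  shows "crosses (diam n c x) (diam n d y) \<longleftrightarrow> c \<noteq> d \<and> x \<noteq> y"
proof -
  have "x mod (2 * n) \<noteq> y mod (2 * n) \<and> x mod (2 * n) \<noteq> (y + n) mod (2 * n)" if "x \<noteq> y"
    using mod_eq_window[of x x "2 * n" y] mod_eq_window[of x x "2 * n" "y + n"] that assms by auto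
  then show ?thesis by (auto simp: diam_def doubleton_eq_iff)
qed

text \<open>Diameters with different endpoints separate each other whatever their colours; if a
  chord is involved, crossing is separation by definition. So chords and diameters can be excluded
  by the same order argument.\<close>

lemma crosses_imp_separated:
  assumes "a \<in> arcs n" "b \<in> arcs n" "0 < n" "crosses a b"
  shows "separated (endpoints a) (endpoints b)"
proof (cases "\<exists>c d x y. a = diam n c x \<and> b = diam n d y")
  case True
  then obtain c d x y where ab: "a = diam n c x" "b = diam n d y" by blast
  obtain p' where p': "x \<le> p'" "p' < x + 2 * n" "p' mod (2 * n) = y mod (2 * n)"
    using mod_repr[of "y mod (2 * n)" "2 * n" x] assms(3) by auto
  then have "b = diam n d p'" using ab by (simp add: diameter_mod[symmetric])
  then obtain p where p: "x \<le> p" "p < x + n" "b = diam n d p"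
  proof (cases "p' < x + n")
    case False
    then show ?thesis using \<open>b = diam n d p'\<close> p' diam_shift[of n d "p' - n"]
      by (intro that[of "p' - n"]) auto
  qed (use p' in blast)
  then have "x < p" using crosses_diam[of x p n c d] assms(4) ab by auto
  then show ?thesis using p ab by (auto intro!: separatedI)
next
  case False
  then have "(\<exists>B. a = Chord B) \<or> (\<exists>B. b = Chord B)"
    using assms(1-3) by (metis arcs_cases chord_def)
  then show ?thesis using assms(4) by (cases a; cases b) auto
qed

section \<open>Membership of chords, diameters and sides\<close>

lemma chord_in_arcs_iff:
  assumes "x < y" "y < x + 2 * n"
  shows "chord n x y \<in> arcs n \<longleftrightarrow> x + 1 < y \<and> y + 1 < x + 2 * n \<and> y \<noteq> x + n"
proof
  assume "chord n x y \<in> arcs n"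
  then obtain i j where ij: "{x mod (2 * n), y mod (2 * n)} = {i, j}" "\<not> neighbours n i j" "j \<noteq> opposite n i"
    "i < 2 * n" "j < 2 * n"
    unfolding arcs_def chord_def diameter_def by auto
  \<comment> \<open>The equality of sets may match the ends in either order, so being opposite has
    to be symmetric.\<close>
  have "i \<noteq> opposite n j"
  proof
    assume "i = opposite n j"
    then have "i = (j + n) mod (2 * n)" by (simp add: opposite_def)
    then have "opposite n i = (j + n + n) mod (2 * n)" using opposite_mod by metis
    then show False using ij add_twice_mod by simp
  qed
  then have "\<not> neighbours n (x mod (2 * n)) (y mod (2 * n))"
    and "y mod (2 * n) \<noteq> opposite n (x mod (2 * n))"
    using ij unfolding doubleton_eq_iff by (auto simp: neighbours_def)
  then show "x + 1 < y \<and> y + 1 < x + 2 * n \<and> y \<noteq> x + n"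
    using assms neighbours_window[of n x y] opposite_window[of x y n] by auto
qed (use chord_in_arcs in auto)

lemma Diameter_in_arcs_iff:
  assumes "x < y" "y < x + 2 * n"
  shows "Diameter c {x mod (2 * n), y mod (2 * n)} \<in> arcs n \<longleftrightarrow> y = x + n"
proof
  assume "Diameter c {x mod (2 * n), y mod (2 * n)} \<in> arcs n"
  then obtain i where i: "{x mod (2 * n), y mod (2 * n)} = {i, opposite n i}" "i < 2 * n"
    unfolding arcs_def diameter_def by auto
  have "opposite n (opposite n i) = i"
    using opposite_mod[of n i] opposite_mod[of n "i + n"] add_twice_mod[of i n] i(2) by simp
  then have "y mod (2 * n) = opposite n (x mod (2 * n))"
    using i unfolding doubleton_eq_iff by auto
  then show "y = x + n" using opposite_window assms by blast
next
  assume "y = x + n"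
  then show "Diameter c {x mod (2 * n), y mod (2 * n)} \<in> arcs n"
    using diam_in_arcs[of n c x] assms by (auto simp: diam_def)
qed

lemma arcs_between_window:
  assumes "x < y" "y < x + 2 * n"
  shows "arcs_between n (x mod (2 * n)) (y mod (2 * n)) =
    (if y = x + n then range (\<lambda>c. diam n c x)
     else if x + 1 < y \<and> y + 1 < x + 2 * n then {chord n x y} else {})"
    (is "?A = ?B")
proof -
  have "b \<in> ?A \<longleftrightarrow> b \<in> ?B" for b
  proof (cases b)
    case (Chord A)
    then have "b \<in> ?A \<longleftrightarrow> b = chord n x y \<and> chord n x y \<in> arcs n"
      unfolding arcs_between_def chord_def by auto
    then show ?thesis using Chord chord_in_arcs_iff[OF assms] by (auto simp: diam_def)
  next
    case (Diameter c A)
    then have "b \<in> ?A \<longleftrightarrow> A = {x mod (2 * n), y mod (2 * n)} \<and>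
        Diameter c {x mod (2 * n), y mod (2 * n)} \<in> arcs n"
      unfolding arcs_between_def by auto
    then show ?thesis using Diameter Diameter_in_arcs_iff[OF assms] by (auto simp: diam_def chord_def)
  qed
  then show ?thesis by blast
qed

lemma side_window:
  assumes "x < y" "y < x + 2 * n"
  shows "side n X x y \<longleftrightarrow>
    (if y = x + n then \<forall>c. diam n c x \<in> X
     else x + 1 < y \<longrightarrow> y + 1 < x + 2 * n \<longrightarrow> chord n x y \<in> X)"
  unfolding side_def arcs_between_window[OF assms] by auto

section \<open>Criteria for membership in \<open>nc\<close>\<close>

text \<open>Colours are ignored: crossing arcs have separated endpoints, so if no member of
  \<open>Y\<close> has an end strictly on each side of \<open>{x, y}\<close>, then every copy of
  \<open>{x, y}\<close> lies in \<open>nc n Y\<close>.\<close>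

lemma side_sepI:
  assumes "0 < n" "Y \<subseteq> arcs n" "x < y" "y < x + 2 * n"
    and no: "\<And>b p q. b \<in> Y \<Longrightarrow> x < p \<Longrightarrow> p < y \<Longrightarrow> y < q \<Longrightarrow> q < x + 2 * n \<Longrightarrow>
      endpoints b = {p mod (2 * n), q mod (2 * n)} \<Longrightarrow>
      b = chord n p q \<or> q = p + n \<and> (\<exists>c. b = diam n c p) \<Longrightarrow> False"
  shows "side n (nc n Y) x y"
proof -
  have "a \<in> nc n Y" if a: "a \<in> arcs n" "endpoints a = {x mod (2 * n), y mod (2 * n)}" for a
  proof -
    have "\<not> crosses a b" if b: "b \<in> Y" for b
    proof
      assume "crosses a b"
      then have "separated {x mod (2 * n), y mod (2 * n)} (endpoints b)"
        using crosses_imp_separated[of a n b] a b assms(1,2) by auto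
      then obtain p q where "x < p" "p < y" "y < q" "q < x + 2 * n"
        "endpoints b = {p mod (2 * n), q mod (2 * n)}"
        "b = chord n p q \<or> q = p + n \<and> (\<exists>c. b = diam n c p)"
        by (rule crossing_lift[OF subsetD[OF assms(2) b] assms(1,3,4)])
      then show False using no[OF b] by blast
    qed
    then show ?thesis using a by (simp add: nc_def)
  qed
  then show ?thesis unfolding side_def arcs_between_def by auto
qed

lemma nc_chordI:
  assumes "0 < n" "Y \<subseteq> arcs n" "x + 1 < y" "y + 1 < x + 2 * n" "y \<noteq> x + n"
    and "\<And>p q. chord n p q \<in> Y \<Longrightarrow> x < p \<Longrightarrow> p < y \<Longrightarrow> y < q \<Longrightarrow> q < x + 2 * n \<Longrightarrow> False"
    and "\<And>c p. diam n c p \<in> Y \<Longrightarrow> x < p \<Longrightarrow> p < y \<Longrightarrow> y < p + n \<Longrightarrow> p + n < x + 2 * n \<Longrightarrow> False"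
  shows "chord n x y \<in> nc n Y"
proof -
  have "side n (nc n Y) x y"
    by (rule side_sepI) (use assms in auto)
  then show ?thesis using assms by (simp add: side_window)
qed

text \<open>In contrast to \<open>side_sepI\<close> a single colour is treated, so that only
  diameters of the other colour have to be excluded.\<close>

lemma nc_diamI:
  assumes "0 < n" "Y \<subseteq> arcs n"
    and chords: "\<And>p q. chord n p q \<in> Y \<Longrightarrow> x < p \<Longrightarrow> p < x + n \<Longrightarrow> x + n < q \<Longrightarrow> q < x + 2 * n \<Longrightarrow> False"
    and diams: "\<And>d p. diam n d p \<in> Y \<Longrightarrow> d \<noteq> c \<Longrightarrow> x < p \<Longrightarrow> p < x + n \<Longrightarrow> False"
  shows "diam n c x \<in> nc n Y"
proof -
  have "\<not> crosses (diam n c x) b" if b: "b \<in> Y" for b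
  proof
    assume cr: "crosses (diam n c x) b"
    have bn: "b \<in> arcs n" using b assms(2) by blast
    have "separated {x mod (2 * n), (x + n) mod (2 * n)} (endpoints b)"
      using crosses_imp_separated[OF _ bn assms(1) cr] diam_in_arcs[OF assms(1)] by simp
    then obtain p q where pq: "x < p" "p < x + n" "x + n < q" "q < x + 2 * n"
      "b = chord n p q \<or> q = p + n \<and> (\<exists>c. b = diam n c p)"
      by (rule crossing_lift[OF bn assms(1), of x "x + n", rotated 2]) (use assms(1) in auto)
    then consider "b = chord n p q" | d where "b = diam n d p" by blast
    then show False
    proof cases
      case 1
      then show False using chords[of p q] pq b by auto
    next
      case 2
      then show False using diams[of d p] crosses_diam[of x p n c d] pq b cr by auto
    qed
  qed
  then show ?thesis using diam_in_arcs[OF assms(1)] by (simp add: nc_def)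
qed

lemma nc_no_cross: "a \<in> nc n Y \<Longrightarrow> b \<in> Y \<Longrightarrow> \<not> crosses a b"
  by (simp add: nc_def)

section \<open>The Ptolemy conditions in a window\<close>

text \<open>Reading the same crossing from another of its four ends permutes the four demanded sides
  cyclically, so it is enough to demand the side from the first end to the second in every reading.
  Ends that move to the back are raised by \<open>2 * n\<close>.\<close>

lemma Pt1_iff:
  assumes "0 < n" "X \<subseteq> arcs n"
  shows "Pt1 n X \<longleftrightarrow> (\<forall>i k j l. i < k \<longrightarrow> k < j \<longrightarrow> j < l \<longrightarrow> l < i + 2 * n \<longrightarrow>
    chord n i j \<in> X \<longrightarrow> chord n k l \<in> X \<longrightarrow> side n X i k)" (is "_ \<longleftrightarrow> ?R")
proof
  assume P: "Pt1 n X"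
  show ?R
  proof (intro allI impI)
    fix i k j l
    assume o: "i < k" "k < j" "j < l" "l < i + 2 * n" and X: "chord n i j \<in> X" "chord n k l \<in> X"
    then have "crosses (chord n i j) (chord n k l)" by (simp add: separatedI)
    then show "side n X i k"
      using P X unfolding Pt1_def chord_def side_def by blast
  qed
next
  assume R: ?R
  show "Pt1 n X"
    unfolding Pt1_def
  proof (intro allI impI)
    fix i j k l
    assume A: "Chord {i, j} \<in> X \<and> Chord {k, l} \<in> X \<and> crosses (Chord {i, j}) (Chord {k, l})"
    then have "Chord {i, j} \<in> arcs n" "Chord {k, l} \<in> arcs n" using assms by auto
    then have lt: "i < 2 * n" "j < 2 * n" and "i \<noteq> j"
      unfolding arcs_def diameter_def by (auto simp: doubleton_eq_iff)
    obtain J where J: "i \<le> J" "J < i + 2 * n" "J mod (2 * n) = j" using mod_repr lt by blast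
    have "i < J" using J lt \<open>i \<noteq> j\<close> by (cases "i = J") auto
    have ij: "{i, j} = {i mod (2 * n), J mod (2 * n)}" using J lt by simp
    have "separated {i mod (2 * n), J mod (2 * n)} (endpoints (Chord {k, l}))" using A ij by simp
    then obtain p q where pq: "i < p" "p < J" "J < q" "q < i + 2 * n"
      "{k, l} = {p mod (2 * n), q mod (2 * n)}"
      using crossing_lift[OF \<open>Chord {k, l} \<in> arcs n\<close> assms(1) \<open>i < J\<close> J(2)]
      by (metis arc.sel(1))
    have X: "chord n i J \<in> X" "chord n p q \<in> X" using A pq ij by (simp_all add: chord_def)
    have "side n X i p" using R pq X by blast
    moreover have "side n X p J"
      using R[rule_format, of p J q "i + 2 * n"] pq X by (simp add: chord_shift chord_commute)
    moreover have "side n X J q"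
      using R[rule_format, of J q "i + 2 * n" "p + 2 * n"] pq X by (simp add: chord_shift chord_commute)
    moreover have "side n X i q"
      using R[rule_format, of q "i + 2 * n" "p + 2 * n" "J + 2 * n"] pq X
      by (simp add: chord_shift side_shift chord_commute side_commute)
    ultimately show "arcs_between n i k \<union> arcs_between n i l \<union> arcs_between n j k \<union> arcs_between n j l \<subseteq> X"
      using pq(5) J lt unfolding side_def
      by (auto simp: doubleton_eq_iff arcs_between_def insert_commute)
  qed
qed

lemma diameter_window:
  assumes "diameter n c i \<in> arcs n"
  obtains "i < 2 * n"
proof -
  obtain k where "{i, opposite n i} = {k, opposite n k}" "k < 2 * n"
    using assms unfolding arcs_def diameter_def by auto
  then have "i < 2 * n" by (auto simp: doubleton_eq_iff opposite_def)
  then show thesis by (rule that)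
qed

text \<open>The four ends come in the order \<open>i, k, i + n, k + n\<close>. Each diameter may be
  named by either end, so the other three sides arise from the first by shifting by \<open>n\<close>
  and exchanging the roles of the diameters.\<close>

lemma Pt2_iff:
  assumes "0 < n" "X \<subseteq> arcs n"
  shows "Pt2 n X \<longleftrightarrow> (\<forall>i k c d. i < k \<longrightarrow> k < i + n \<longrightarrow> c \<noteq> d \<longrightarrow>
    diam n c i \<in> X \<longrightarrow> diam n d k \<in> X \<longrightarrow> side n X i k)" (is "_ \<longleftrightarrow> ?R")
proof
  assume P: "Pt2 n X"
  show ?R
  proof (intro allI impI)
    fix i k c d
    assume o: "i < k" "k < i + n" "c \<noteq> d" and X: "diam n c i \<in> X" "diam n d k \<in> X"
    then have "crosses (diam n c i) (diam n d k)" by (simp add: crosses_diam)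
    then show "side n X i k"
      using P X unfolding Pt2_def Let_def diameter_mod[symmetric] side_def by blast
  qed
next
  assume R: ?R
  show "Pt2 n X"
    unfolding Pt2_def Let_def
  proof (intro allI impI)
    fix c d i k
    assume A: "diameter n c i \<in> X \<and> diameter n d k \<in> X \<and> crosses (diameter n c i) (diameter n d k)"
    then have lt: "i < 2 * n" "k < 2 * n" using assms(2) diameter_window by (metis subsetD)+
    have ik: "diameter n c i = diam n c i" "diameter n d k = diam n d k"
      using lt by (simp_all add: diameter_eq_diam)
    have "separated {i mod (2 * n), (i + n) mod (2 * n)} (endpoints (diam n d k))"
      using crosses_imp_separated[of "diam n c i" n "diam n d k"] A assms ik by auto
    then obtain p where pq: "i < p" "p < i + n" "diam n d k = diam n d p"
      by (rule crossing_lift_diam[rotated 3]) (use assms(1) in auto)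
    then have ep: "{k, opposite n k} = {p mod (2 * n), (p + n) mod (2 * n)}"
      using lt endpoints_diam[of n d k] endpoints_diam[of n d p] by (simp add: opposite_def)
    have "c \<noteq> d" using A by (simp add: diameter_def)
    have X: "diam n c i \<in> X" "diam n d p \<in> X" using A ik pq by simp_all
    have "side n X i p" using R pq X \<open>c \<noteq> d\<close> by blast
    moreover have "side n X (i + n) p"
      using R[rule_format, of p "i + n" d c] pq X \<open>c \<noteq> d\<close> by (simp add: diam_shift side_commute)
    moreover have "side n X (i + n) (p + n)"
      using R[rule_format, of "i + n" "p + n" c d] pq X \<open>c \<noteq> d\<close> by (simp add: diam_shift)
    moreover have "side n X (p + n) (i + n + n)"
      using R[rule_format, of "p + n" "i + n + n" d c] pq X \<open>c \<noteq> d\<close> by (simp add: diam_shift)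
    then have "side n X i (p + n)"
      by (simp add: side_def add_twice_mod arcs_between_def insert_commute)
    moreover have "i mod (2 * n) = i" "opposite n i = (i + n) mod (2 * n)"
      using lt by (auto simp: opposite_def)
    ultimately show "arcs_between n i k \<union> arcs_between n i (opposite n k) \<union>
        arcs_between n (opposite n i) k \<union> arcs_between n (opposite n i) (opposite n k) \<subseteq> X"
      using ep unfolding side_def by (auto simp: doubleton_eq_iff)
  qed
qed

text \<open>Let \<open>i\<close> be the end of the diameter on the short side of
  \<open>{k, l}\<close>. The arcs from \<open>i\<close> to \<open>k\<close> and \<open>l\<close> do
  not cross the rotated chord, those from \<open>i + n\<close> do; so the restriction in the
  definition selects exactly the two sides at \<open>i\<close>.\<close>

lemma Pt3_iff:
  assumes "0 < n" "X \<subseteq> arcs n"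
  shows "Pt3 n X \<longleftrightarrow> (\<forall>k i l c. k < i \<longrightarrow> i < l \<longrightarrow> l < k + n \<longrightarrow>
    diam n c i \<in> X \<longrightarrow> chord n k l \<in> X \<longrightarrow>
    side n X k i \<and> side n X i l \<and> diam n c k \<in> X \<and> diam n c l \<in> X)" (is "_ \<longleftrightarrow> ?R")
proof
  assume P: "Pt3 n X"
  show ?R
  proof (intro allI impI)
    fix k i l c
    assume o: "k < i" "i < l" "l < k + n" and X: "diam n c i \<in> X" "chord n k l \<in> X"
    let ?i = "i mod (2 * n)" and ?k = "k mod (2 * n)" and ?l = "l mod (2 * n)"
    have "separated {k mod (2 * n), l mod (2 * n)} {i mod (2 * n), (i + n) mod (2 * n)}"
      by (rule separatedI) (use o in auto)
    then have "crosses (diameter n c ?i) (Chord {?k, ?l})"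
      by (simp add: diameter_mod separated_commute)
    then have *: "{a \<in> arcs_between n ?i ?k \<union> arcs_between n ?i ?l \<union>
        arcs_between n (opposite n ?i) ?k \<union> arcs_between n (opposite n ?i) ?l.
          \<not> crosses a (Chord {opposite n ?k, opposite n ?l})} \<subseteq> X"
      "diameter n c ?k \<in> X" "diameter n c ?l \<in> X"
      using P X unfolding Pt3_def Let_def diameter_mod[symmetric] chord_def by blast+
    have "\<not> crosses a (Chord {opposite n ?k, opposite n ?l})"
      if "a \<in> arcs_between n ?i ?k \<union> arcs_between n ?i ?l" for a
    proof -
      have "\<not> separated {k mod (2 * n), i mod (2 * n)} {(k + n) mod (2 * n), (l + n) mod (2 * n)}"
        by (subst separated_window) (use o in auto)
      moreover have "\<not> separated {i mod (2 * n), l mod (2 * n)} {(k + n) mod (2 * n), (l + n) mod (2 * n)}"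
        by (subst separated_window) (use o in auto)
      moreover have "endpoints a = {?k, ?i} \<or> endpoints a = {?i, ?l}"
        using that by (auto simp: arcs_between_def)
      ultimately show ?thesis by (auto simp: opposite_mod)
    qed
    then have "side n X i k" "side n X i l" using *(1) unfolding side_def by blast+
    then show "side n X k i \<and> side n X i l \<and> diam n c k \<in> X \<and> diam n c l \<in> X"
      using *(2,3) by (simp add: side_commute diameter_mod)
  qed
next
  assume R: ?R
  show "Pt3 n X"
    unfolding Pt3_def Let_def
  proof (intro allI impI)
    fix c i k l
    assume A: "diameter n c i \<in> X \<and> Chord {k, l} \<in> X \<and> crosses (diameter n c i) (Chord {k, l})"
    then have lt: "i < 2 * n" using assms(2) diameter_window by (metis subsetD)
    then have i: "diameter n c i = diam n c i" "i mod (2 * n) = i" "opposite n i = (i + n) mod (2 * n)"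
      by (simp_all add: diameter_eq_diam opposite_def)
    have "Chord {k, l} \<in> arcs n" using A assms(2) by blast
    then obtain K L where KL: "Chord {k, l} = chord n K L" "K + 1 < L" "L < K + n"
      using assms(1) by (auto elim!: arcs_cases simp: diam_def)
    then have kl: "{k, l} = {K mod (2 * n), L mod (2 * n)}" by (simp add: chord_def)
    have "separated {K mod (2 * n), L mod (2 * n)} (endpoints (diam n c i))"
      using A unfolding i kl by (simp add: separated_commute)
    then obtain p where pq: "K < p" "p < L" "diam n c i = diam n c p"
      by (rule crossing_lift_diam[rotated 3]) (use KL assms(1) in auto)
    have ep: "{i, opposite n i} = {p mod (2 * n), (p + n) mod (2 * n)}"
      using pq i endpoints_diam[of n c i] endpoints_diam[of n c p] by simp
    have X: "diam n c p \<in> X" "chord n K L \<in> X" using A i KL pq by simp_all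
    have *: "side n X p K" "side n X p L" "diam n c K \<in> X" "diam n c L \<in> X"
      using R[rule_format, of K p L c] KL pq X by (auto simp: side_commute)
    \<comment> \<open>The vertex \<open>p + n\<close> lies strictly between \<open>K + n\<close> and
      \<open>L + n\<close>, while \<open>K\<close> and \<open>L\<close> lie outside that
      path.\<close>
    have sep: "separated {(p + n) mod (2 * n), K mod (2 * n)} {(K + n) mod (2 * n), (L + n) mod (2 * n)}"
      "separated {(p + n) mod (2 * n), L mod (2 * n)} {(K + n) mod (2 * n), (L + n) mod (2 * n)}"
      by (subst insert_commute, subst separated_window; use KL pq in auto)+
    have opp: "{opposite n k, opposite n l} = {(K + n) mod (2 * n), (L + n) mod (2 * n)}"
      using kl opposite_mod by (auto simp: doubleton_eq_iff)
    have "a \<in> X"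
      if a: "a \<in> arcs_between n i k \<union> arcs_between n i l \<union>
          arcs_between n (opposite n i) k \<union> arcs_between n (opposite n i) l"
        and nc: "\<not> crosses a (Chord {opposite n k, opposite n l})" for a
    proof -
      from a have an: "a \<in> arcs n" and "\<exists>x \<in> {i, opposite n i}. \<exists>y \<in> {k, l}. endpoints a = {x, y}"
        unfolding arcs_between_def by auto
      then have "endpoints a = {p mod (2 * n), K mod (2 * n)} \<or> endpoints a = {p mod (2 * n), L mod (2 * n)}
          \<or> endpoints a = {(p + n) mod (2 * n), K mod (2 * n)} \<or> endpoints a = {(p + n) mod (2 * n), L mod (2 * n)}"
        unfolding ep kl by blast
      moreover have "\<not> separated (endpoints a) {(K + n) mod (2 * n), (L + n) mod (2 * n)}"
        using nc by (simp add: opp)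
      ultimately have "endpoints a = {p mod (2 * n), K mod (2 * n)} \<or> endpoints a = {p mod (2 * n), L mod (2 * n)}"
        using sep by metis
      then show "a \<in> X" using * an unfolding side_def arcs_between_def by blast
    qed
    moreover have "diameter n c k \<in> X \<and> diameter n c l \<in> X"
      using *(3,4) kl by (auto simp: doubleton_eq_iff diameter_mod)
    ultimately show "{a \<in> arcs_between n i k \<union> arcs_between n i l \<union>
        arcs_between n (opposite n i) k \<union> arcs_between n (opposite n i) l.
        \<not> crosses a (Chord {opposite n k, opposite n l})} \<subseteq> X \<and>
      diameter n c k \<in> X \<and> diameter n c l \<in> X"
      by blast
  qed
qed

section \<open>The Ptolemy conditions for sets of the form \<open>nc n Y\<close>\<close>

lemma rot180_chord_mem:
  assumes "rot180 n ` X = X"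
  shows "chord n (x + n) (y + n) \<in> X \<longleftrightarrow> chord n x y \<in> X"
proof -
  have *: "chord n (x + n) (y + n) \<in> X" if "chord n x y \<in> X" for x y
    using that assms rot180_chord by (metis imageI)
  have "chord n (x + n + n) (y + n + n) = chord n x y"
    by (simp add: chord_def add_twice_mod)
  then show ?thesis using * by metis
qed

context
  fixes n :: nat and Y :: "arc set"
  assumes n: "0 < n" and Y: "Y \<subseteq> arcs n" and rot: "rot180 n ` Y = Y"
begin

lemma nc_chordD:
  assumes "chord n i j \<in> nc n Y" "b \<in> Y" "endpoints b = {p mod (2 * n), q mod (2 * n)}"
    and "i < p \<and> p < j \<and> j < q \<and> q < i + 2 * n \<or> p < i \<and> i < q \<and> q < j \<and> j < p + 2 * n"
  shows False
proof -
  have "separated {i mod (2 * n), j mod (2 * n)} {p mod (2 * n), q mod (2 * n)}"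
    using assms(4) separatedI[of i p j q n] separatedI[of p i q j n] separated_commute by blast
  then show False using nc_no_cross[OF assms(1,2)] assms(3) by simp
qed

lemma nc_diamD_chord:
  assumes "diam n c i \<in> nc n Y" "chord n p q \<in> Y"
    and "i < p \<and> p < i + n \<and> i + n < q \<and> q < i + 2 * n \<or> p < i \<and> i < q \<and> q < i + n \<and> i + n < p + 2 * n"
  shows False
proof -
  have "separated {i mod (2 * n), (i + n) mod (2 * n)} {p mod (2 * n), q mod (2 * n)}"
    using assms(3) separatedI[of i p "i + n" q n] separatedI[of p i q "i + n" n] separated_commute by blast
  then show False using nc_no_cross[OF assms(1,2)] by (simp add: diam_def chord_def)
qed

lemma nc_diamD_diam:
  assumes "diam n c i \<in> nc n Y" "diam n d p \<in> Y" "c \<noteq> d" "i < p \<and> p < i + n \<or> p < i \<and> i < p + n"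
  shows False
  using nc_no_cross[OF assms(1,2)] crosses_diam[of i p n c d] crosses_diam[of p i n d c] assms(3,4)
  by (auto simp: crosses_commute)

text \<open>An arc crossing \<open>{i, k}\<close> has an end between \<open>i\<close> and
  \<open>k\<close>. If its other end comes before \<open>l\<close> it crosses \<open>{k, l}\<close>,
  otherwise it crosses \<open>{i, j}\<close>.\<close>

lemma Pt1_nc: "Pt1 n (nc n Y)"
proof -
  have "side n (nc n Y) i k"
    if o: "i < k" "k < j" "j < l" "l < i + 2 * n" and X: "chord n i j \<in> nc n Y" "chord n k l \<in> nc n Y"
    for i k j l
  proof (rule side_sepI[OF n Y])
    fix b p q
    assume b: "b \<in> Y" "i < p" "p < k" "k < q" "q < i + 2 * n" "endpoints b = {p mod (2 * n), q mod (2 * n)}"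
    show False
    proof (cases "q < l")
      case True
      then show False using nc_chordD[OF X(2) b(1,6)] b o by auto
    next
      case False
      then show False using nc_chordD[OF X(1) b(1,6)] b o by auto
    qed
  qed (use o in auto)
  moreover have "nc n Y \<subseteq> arcs n" by (auto simp: nc_def)
  ultimately show ?thesis using Pt1_iff[OF n] by blast
qed

text \<open>A chord crossing \<open>{i, k}\<close> crosses one of the two diameters. A diameter with
  an end between \<open>i\<close> and \<open>k\<close> meets both of them inside the polygon, and
  its colour differs from at least one of theirs.\<close>

lemma Pt2_nc: "Pt2 n (nc n Y)"
proof -
  have "side n (nc n Y) i k"
    if o: "i < k" "k < i + n" "c \<noteq> d" and X: "diam n c i \<in> nc n Y" "diam n d k \<in> nc n Y"
    for i k c d
  proof (rule side_sepI[OF n Y])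
    fix b p q
    assume b: "b \<in> Y" "i < p" "p < k" "k < q" "q < i + 2 * n" "endpoints b = {p mod (2 * n), q mod (2 * n)}"
      "b = chord n p q \<or> q = p + n \<and> (\<exists>e. b = diam n e p)"
    from b(7) show False
    proof (elim disjE conjE exE)
      assume "b = chord n p q"
      then show False
        using nc_diamD_chord[OF X(1), of p q] nc_diamD_chord[OF X(2), of p q] b o
        by (cases "q < k + n") auto
    next
      fix e assume "b = diam n e p"
      then show False
        using nc_diamD_diam[OF X(1), of e p] nc_diamD_diam[OF X(2), of e p] b o
        by (cases "e = c") auto
    qed
  qed (use o in auto)
  moreover have "nc n Y \<subseteq> arcs n" by (auto simp: nc_def)
  ultimately show ?thesis using Pt2_iff[OF n] by blast
qed

text \<open>An arc crossing one of the two sides crosses \<open>{k, l}\<close> or the diameter at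
  \<open>i\<close>. For the diameters at \<open>k\<close> and \<open>l\<close>, a crossing chord or
  its rotation crosses \<open>{k, l}\<close>, or else the chord crosses the diameter at
  \<open>i\<close>; this is where the rotation invariance of \<open>Y\<close> enters.\<close>

lemma Pt3_nc: "Pt3 n (nc n Y)"
proof -
  have "side n (nc n Y) k i \<and> side n (nc n Y) i l \<and> diam n c k \<in> nc n Y \<and> diam n c l \<in> nc n Y"
    if o: "k < i" "i < l" "l < k + n" and X: "diam n c i \<in> nc n Y" "chord n k l \<in> nc n Y"
    for k i l c
  proof (intro conjI)
    have X': "diam n c (i + n) \<in> nc n Y" using X(1) by (simp add: diam_shift)
    have X'': "chord n (k + 2 * n) (l + 2 * n) \<in> nc n Y" using X(2) by (simp add: chord_shift)
    \<comment> \<open>A diameter on the endpoints of the given one does not cross it in either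
      colour, so this position is excluded by the chord instead.\<close>
    have no_i: False if "diam n e i \<in> Y" for e
      using nc_chordD[OF X(2) that, of i "i + n"] o by auto
    show "side n (nc n Y) k i"
    proof (rule side_sepI[OF n Y])
      fix b p q
      assume b: "b \<in> Y" "k < p" "p < i" "i < q" "q < k + 2 * n" "endpoints b = {p mod (2 * n), q mod (2 * n)}"
        "b = chord n p q \<or> q = p + n \<and> (\<exists>e. b = diam n e p)"
      show False
      proof (cases "q > l")
        case True
        then show False using nc_chordD[OF X(2) b(1,6)] b o by auto
      next
        case False
        then show False using nc_diamD_chord[OF X(1), of p q] b o by auto
      qed
    qed (use o in auto)
    show "side n (nc n Y) i l"
    proof (rule side_sepI[OF n Y])
      fix b p q
      assume b: "b \<in> Y" "i < p" "p < l" "l < q" "q < i + 2 * n" "endpoints b = {p mod (2 * n), q mod (2 * n)}"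
        "b = chord n p q \<or> q = p + n \<and> (\<exists>e. b = diam n e p)"
      show False
      proof (cases "q < k + 2 * n")
        case True
        then show False using nc_chordD[OF X(2) b(1,6)] b o by auto
      next
        case False
        then show False using nc_diamD_chord[OF X(1), of p q] b o by auto
      qed
    qed (use o in auto)
    show "diam n c k \<in> nc n Y"
    proof (rule nc_diamI[OF n Y])
      fix p q
      assume b: "chord n p q \<in> Y" "k < p" "p < k + n" "k + n < q" "q < k + 2 * n"
      have q: "chord n (q - n) (p + n) \<in> Y"
      proof -
        have "q + n = (q - n) + 2 * n" using b by simp
        then have "chord n (p + n) (q - n) \<in> Y"
          using b(1) rot180_chord_mem[OF rot, of p q] chord_shift(2) by metis
        then show ?thesis by (simp add: chord_commute)
      qed
      consider "p < l" | "q - n < l" | "l \<le> p" "l + n \<le> q" using b by linarith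
      then show False
      proof cases
        case 1
        then show False using nc_chordD[OF X(2) b(1), of p q] b o by auto
      next
        case 2
        then show False using nc_chordD[OF X(2) q, of "q - n" "p + n"] b o by (auto simp: less_diff_conv)
      next
        case 3
        then show False using nc_diamD_chord[OF X(1) b(1)] b o by auto
      qed
    next
      fix d p
      assume b: "diam n d p \<in> Y" "d \<noteq> c" "k < p" "p < k + n"
      then show False using nc_diamD_diam[OF X(1) b(1)] no_i o
        by (cases p i rule: linorder_cases) auto
    qed
    show "diam n c l \<in> nc n Y"
    proof (rule nc_diamI[OF n Y])
      fix p q
      assume b: "chord n p q \<in> Y" "l < p" "p < l + n" "l + n < q" "q < l + 2 * n"
      have q: "chord n (p + n) (q + n) \<in> Y"
        using b rot180_chord_mem[OF rot] by simp
      consider "q > k + 2 * n" | "p > k + n" "q \<le> k + 2 * n" | "p \<le> k + n" "q \<le> k + 2 * n" by linarith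
      then show False
      proof cases
        case 1
        then show False using nc_chordD[OF X'' b(1), of p q] b o by auto
      next
        case 2
        then show False using nc_chordD[OF X'' q, of "p + n" "q + n"] b o by auto
      next
        case 3
        then show False using nc_diamD_chord[OF X(1) b(1)] b o by auto
      qed
    next
      fix d p
      assume b: "diam n d p \<in> Y" "d \<noteq> c" "l < p" "p < l + n"
      then show False
        using nc_diamD_diam[OF X' b(1)] no_i[of d] diam_shift[of n d i] o
        by (cases p "i + n" rule: linorder_cases) auto
    qed
  qed
  moreover have "nc n Y \<subseteq> arcs n" by (auto simp: nc_def)
  ultimately show ?thesis using Pt3_iff[OF n] by blast
qed

end

text \<open>Rotation preserves crossing and is an involution on arcs: if \<open>b\<close> crosses
  the rotation of a chord \<open>a\<close>, then the rotation of \<open>b\<close>, again in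
  \<open>X\<close>, crosses \<open>a\<close>. Diameters are fixed.\<close>

lemma rot180_nc:
  assumes n: "0 < n" and X: "X \<subseteq> arcs n" and rot: "rot180 n ` X = X"
  shows "rot180 n ` nc n X = nc n X"
proof -
  have twice: "rot180 n (rot180 n a) = a" if "a \<in> arcs n" for a
    using that n
    by (cases rule: arcs_cases) (simp_all add: rot180_chord rot180_diam, simp add: chord_def add_twice_mod)
  have arcs: "rot180 n a \<in> arcs n" if "a \<in> arcs n" for a
    using that n
  proof (cases rule: arcs_cases)
    case (chord x y)
    then show ?thesis by (auto simp: rot180_chord intro!: chord_in_arcs)
  next
    case (diam c x)
    then show ?thesis using n by (simp add: rot180_diam diam_in_arcs)
  qed
  have sub: "rot180 n a \<in> nc n X" if a: "a \<in> nc n X" for a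
  proof -
    have an: "a \<in> arcs n" using a by (simp add: nc_def)
    have "\<not> crosses (rot180 n a) b" if b: "b \<in> X" for b
      using an n
    proof (cases rule: arcs_cases)
      case (chord x y)
      show ?thesis
      proof
        assume "crosses (rot180 n a) b"
        then have "separated {(x + n) mod (2 * n), (y + n) mod (2 * n)} (endpoints b)"
          using chord by (simp add: rot180_chord)
        then obtain p q where pq: "x + n < p" "p < y + n" "y + n < q" "q < x + n + 2 * n"
            "endpoints b = {p mod (2 * n), q mod (2 * n)}"
          by (rule crossing_lift[rotated 4]) (use b X chord n in auto)
        have "endpoints (rot180 n b) = {(p + n) mod (2 * n), (q + n) mod (2 * n)}"
          using pq(5) by (cases b) (auto simp: rot180_def opposite_mod)
        moreover have "separated {(x + 2 * n) mod (2 * n), (y + 2 * n) mod (2 * n)} {(p + n) mod (2 * n), (q + n) mod (2 * n)}"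
          by (rule separatedI) (use pq in auto)
        ultimately have "crosses a (rot180 n b)" using chord by simp
        then show False using a b rot by (auto simp: nc_def)
      qed
    next
      case (diam c x)
      then show ?thesis using a b by (simp add: rot180_diam nc_def)
    qed
    then show ?thesis using arcs[OF an] by (simp add: nc_def)
  qed
  have "a \<in> rot180 n ` nc n X" if "a \<in> nc n X" for a
    using sub[OF that] twice[of a] that by (metis (no_types, lifting) image_eqI mem_Collect_eq nc_def)
  then show ?thesis using sub by blast
qed

section \<open>Joining a vertex to crossing arcs in a Ptolemy diagram\<close>

locale ptolemy =
  fixes n :: nat and X :: "arc set"
  assumes n: "1 < n" and X: "X \<subseteq> arcs n" and rot: "rot180 n ` X = X"
    and Pts: "Pt1 n X" "Pt2 n X" "Pt3 n X"
begin

lemma n0: "0 < n" using n by simp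

lemma p1: "i < k \<Longrightarrow> k < j \<Longrightarrow> j < l \<Longrightarrow> l < i + 2 * n \<Longrightarrow>
    chord n i j \<in> X \<Longrightarrow> chord n k l \<in> X \<Longrightarrow> side n X i k"
  using Pts(1) unfolding Pt1_iff[OF n0 X] by blast

lemma p2: "i < k \<Longrightarrow> k < i + n \<Longrightarrow> c \<noteq> d \<Longrightarrow>
    diam n c i \<in> X \<Longrightarrow> diam n d k \<in> X \<Longrightarrow> side n X i k"
  using Pts(2) unfolding Pt2_iff[OF n0 X] by blast

lemma p3:
  assumes "k < i" "i < l" "l < k + n" "diam n c i \<in> X" "chord n k l \<in> X"
  shows "side n X k i" "side n X i l" "diam n c k \<in> X" "diam n c l \<in> X"
  using Pts(3) assms unfolding Pt3_iff[OF n0 X] by blast+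

lemma chord_mem_side: "chord n x y \<in> X \<Longrightarrow> x < y \<Longrightarrow> y < x + 2 * n \<Longrightarrow> side n X x y"
  using X chord_in_arcs_iff[of x y n] by (auto simp: side_window)

lemma side_rot: "x < y \<Longrightarrow> y < x + 2 * n \<Longrightarrow> side n X (x + n) (y + n) \<longleftrightarrow> side n X x y"
  by (auto simp: side_window diam_shift rot180_chord_mem[OF rot])

lemma side_mem_chord: "side n X x y \<Longrightarrow> x + 1 < y \<Longrightarrow> y + 1 < x + 2 * n \<Longrightarrow> y \<noteq> x + n \<Longrightarrow> chord n x y \<in> X"
  by (simp add: side_window)

lemma side_diam: "side n X x (x + n) \<longleftrightarrow> (\<forall>c. diam n c x \<in> X)"
  using n0 by (simp add: side_window)

text \<open>Vertices strictly on both sides of \<open>{u, w}\<close> rule out a boundary edge, so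
  this side is a chord of \<open>X\<close> and the first Ptolemy condition applies.\<close>

lemma side_chord_cross:
  assumes "side n X u w" "w \<noteq> u + n" "u < p" "p < w" "w < q" "q < u + 2 * n" "chord n p q \<in> X"
  shows "side n X u p" "side n X u q"
proof -
  have uw: "chord n u w \<in> X" using assms by (intro side_mem_chord) auto
  show "side n X u p" using p1[of u p w q] assms uw by simp
  show "side n X u q"
    using p1[of q "u + 2 * n" "p + 2 * n" "w + 2 * n"] assms uw
    by (simp add: chord_shift side_shift chord_commute side_commute)
qed

lemma side_diam_cross_less:
  assumes "side n X u w" "u < p" "p < w" "w < u + n" "diam n c p \<in> X"
  shows "side n X u p" "diam n c u \<in> X"
  using p3[of u p w c] side_mem_chord[of u w] assms by auto

lemma side_diam_cross_greater:
  assumes "side n X u w" "u + n < w" "w < p + n" "p < u + n" "diam n c p \<in> X"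
  shows "diam n c u \<in> X"
proof -
  \<comment> \<open>The short side of the chord runs from \<open>w\<close> to
    \<open>u + 2 * n\<close> and contains the end \<open>p + n\<close> of the diameter.\<close>
  have "chord n w (u + 2 * n) \<in> X"
    using side_mem_chord[of u w] assms by (simp add: chord_shift chord_commute)
  then have "diam n c (u + n + n) \<in> X"
    using p3(4)[of w "p + n" "u + 2 * n" c] assms by (simp add: diam_shift mult_2 add.assoc)
  then show ?thesis by (simp only: diam_shift)
qed

text \<open>The end \<open>q\<close> has passed once around to the stretch from \<open>u\<close> up
  to but excluding \<open>s\<close>. Either it is \<open>u\<close>, and the chord is the desired
  side, or the chord crosses \<open>{u, s}\<close>.\<close>

lemma side_chord_wrap:
  assumes "side n X u s" "u < s" "s < u + n" "s < p" "p < u + 2 * n" "chord n p q \<in> X"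
    "u + 2 * n \<le> q" "q < s + 2 * n"
  shows "side n X u p"
proof -
  define r where "r = q - 2 * n"
  have q: "q = r + 2 * n" using assms by (simp add: r_def)
  have c: "chord n r p \<in> X" using assms(6) by (simp add: q chord_shift chord_commute)
  show ?thesis
  proof (cases "r = u")
    case True
    then show ?thesis using chord_mem_side[OF c] assms q by simp
  next
    case False
    then show ?thesis using side_chord_cross(2)[of u s r p] assms q c by simp
  qed
qed

lemma side_diam_wrap:
  assumes "side n X u s" "s < u + n" "diam n c p \<in> X" "u + n \<le> p" "p < s + n"
  shows "diam n c u \<in> X"
proof -
  define r where "r = p - n"
  have p: "p = r + n" using assms by (simp add: r_def)
  then have "diam n c r \<in> X" using assms(3) by (simp add: diam_shift)
  then show ?thesis using side_diam_cross_less[of u s r c] assms p by (cases "r = u") simp_all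
qed

text \<open>The third Ptolemy condition gives sides only at the end of the diameter on the short
  side of the chord. That end is \<open>u\<close> if \<open>p + n < q\<close> and
  \<open>u + n\<close> if \<open>q < p + n\<close>.\<close>

lemma diam_chord_cross:
  assumes "diam n c u \<in> X" "chord n p q \<in> X" "u < p" "p < u + n" "u + n < q" "q < u + 2 * n"
  shows "diam n c p \<in> X \<and> (p + n < q \<and> side n X u p \<or> q < p + n \<and> side n X (u + n) q)"
proof -
  have "q \<noteq> p + n" using assms X chord_in_arcs_iff[of p q n] by auto
  then consider "p + n < q" | "q < p + n" by linarith
  then show ?thesis
  proof cases
    case 1
    have twice: "diam n c (x + 2 * n) = diam n c x" for x
      using diam_shift[of n c "x + n"] by (simp add: diam_shift mult_2 add.assoc)
    have "side n X (u + 2 * n) (p + 2 * n)" "diam n c (p + 2 * n) \<in> X"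
      using p3[of q "u + 2 * n" "p + 2 * n" c] 1 assms twice by (simp_all add: chord_shift chord_commute)
    then show ?thesis using 1 twice by (simp add: side_shift)
  next
    case 2
    then show ?thesis using p3[of p "u + n" q c] assms by (simp add: diam_shift)
  qed
qed

section \<open>Arcs of \<open>nc n X\<close> cutting off a vertex\<close>

text \<open>Any arc of \<open>X\<close> crossing \<open>{s, t}\<close> at \<open>p\<close> would
  join \<open>u\<close> to \<open>p\<close>, against \<open>gap\<close>. If
  \<open>t = u + n\<close>, both diameters at \<open>u\<close> are in \<open>X\<close>: a chord then
  puts both diameters at \<open>p\<close> into \<open>X\<close>, and two diameters of different
  colours at \<open>u\<close> and \<open>p\<close> give the side.\<close>

lemma nc_consecutive:
  assumes s: "u < s" "side n X u s" and t: "s + 1 < t" "t \<le> u + n" "side n X u t"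
    and gap: "\<And>w. s < w \<Longrightarrow> w < t \<Longrightarrow> \<not> side n X u w"
  shows "chord n s t \<in> nc n X"
proof (rule nc_chordI[OF n0 X])
  fix p q assume b: "chord n p q \<in> X" "s < p" "p < t" "t < q" "q < s + 2 * n"
  consider "q < u + 2 * n" "t < u + n" | "q < u + 2 * n" "t = u + n" | "u + 2 * n \<le> q"
    using t by linarith
  then have "side n X u p"
  proof cases
    case 1
    then show ?thesis using side_chord_cross[of u t p q] b s t by simp
  next
    case 2
    then have D: "diam n c u \<in> X" for c using t(3) side_diam by simp
    have "diam n c p \<in> X" for c
      using diam_chord_cross[OF D b(1)] b s t 2 by simp
    then show ?thesis using p2[of u p Green Red] D b s t by simp
  next
    case 3
    then show ?thesis using side_chord_wrap[of u s p q] b s t by simp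
  qed
  then show False using gap b by blast
next
  fix c p assume b: "diam n c p \<in> X" "s < p" "p < t" "t < p + n" "p + n < s + 2 * n"
  have "side n X u p"
  proof (cases "t < u + n")
    case True
    then show ?thesis using side_diam_cross_less[of u t p c] b s t by simp
  next
    case False
    then have D: "diam n d u \<in> X" for d using t side_diam by simp
    obtain d where "d \<noteq> c" by (metis colour.distinct(1))
    then show ?thesis using p2[of u p d c] D b s t by simp
  qed
  then show False using gap b by blast
qed (use s t n in auto)

text \<open>A chord would join \<open>u\<close> to \<open>p\<close>, against \<open>gap\<close>; a
  diameter would put one of its colour at \<open>u\<close> into \<open>X\<close>, against
  \<open>D\<close>. Speaking of separation covers \<open>{s, t}\<close> both as a chord and as a
  diameter of any colour.\<close>

lemma no_diam_not_separated:
  assumes D: "\<And>c. diam n c u \<notin> X"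
    and s: "u < s" "s < u + n" "side n X u s" and t: "u + n < t" "t < u + 2 * n" "side n X u t"
    and gap: "\<And>w. s < w \<Longrightarrow> w < t \<Longrightarrow> \<not> side n X u w"
    and b: "b \<in> X"
  shows "\<not> separated {s mod (2 * n), t mod (2 * n)} (endpoints b)"
proof
  assume "separated {s mod (2 * n), t mod (2 * n)} (endpoints b)"
  then obtain p q where pq: "s < p" "p < t" "t < q" "q < s + 2 * n"
    and cases: "b = chord n p q \<or> q = p + n \<and> (\<exists>c. b = diam n c p)"
    by (rule crossing_lift[rotated 4]) (use b X s t n in auto)
  from cases show False
  proof (elim disjE conjE exE)
    assume "b = chord n p q"
    then have c: "chord n p q \<in> X" using b by simp
    have "side n X u p"
    proof (cases "q < u + 2 * n")
      case True
      then show ?thesis using side_chord_cross[of u t p q] pq s t c by simp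
    next
      case False
      then show ?thesis using side_chord_wrap[of u s p q] pq s t c by simp
    qed
    then show False using gap pq by blast
  next
    fix c assume q: "q = p + n" and "b = diam n c p"
    then have c: "diam n c p \<in> X" using b by simp
    have "diam n c u \<in> X"
    proof (cases "q < u + 2 * n")
      case True
      then show ?thesis using side_diam_cross_greater[of u t p c] pq s t c q by simp
    next
      case False
      then show ?thesis using side_diam_wrap[of u s c p] pq s t c q by simp
    qed
    then show False using D by blast
  qed
qed

text \<open>The side \<open>{u, s}\<close> and its rotation guard the two ends of the diameter at
  \<open>s\<close>: a crossing arc would join \<open>u\<close> or \<open>u + n\<close> to a vertex
  inside a gap, or bring the missing colour \<open>d\<close> to \<open>u\<close>.\<close>

lemma one_diam_nc:
  assumes D: "diam n c u \<in> X" "diam n d u \<notin> X"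
    and s: "u < s" "s < u + n" "side n X u s"
    and gap: "\<And>w. s < w \<Longrightarrow> w < u + n \<Longrightarrow> \<not> side n X u w"
  shows "diam n c s \<in> nc n X"
proof -
  \<comment> \<open>The gap extends beyond \<open>u + n\<close>: a side \<open>{u, w}\<close> with
    \<open>u + n < w < s + n\<close> would cross the rotated side \<open>{u + n, s + n}\<close>, and
    the first Ptolemy condition would yield both diameters at \<open>u\<close>.\<close>
  have gap': "\<not> side n X u w" if w: "s < w" "w < s + n" for w
  proof
    assume uw: "side n X u w"
    have w': "u + n < w"
    proof (rule ccontr)
      assume "\<not> u + n < w"
      then have "w = u + n" using gap uw w by fastforce
      then show False using uw D side_diam by blast
    qed
    have "side n X (u + n) (s + n)" using side_rot[of u s] s by simp
    then have "chord n (u + n) (s + n) \<in> X" using w w' s by (intro side_mem_chord) auto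
    moreover have "chord n u w \<in> X" using uw w w' s by (intro side_mem_chord) auto
    ultimately have "side n X u (u + n)" using p1[of u "u + n" w "s + n"] w w' s n0 by simp
    then show False using D side_diam by blast
  qed
  have gap'': "\<not> side n X (u + n) w" if "s + n < w" "w < s + 2 * n" for w
    using gap'[of "w - n"] side_rot[of u "w - n"] that s by auto
  have cd: "c \<noteq> d" using D by auto
  show ?thesis
  proof (rule nc_diamI[OF n0 X])
    fix e p assume b: "diam n e p \<in> X" "e \<noteq> c" "s < p" "p < s + n"
    then have e: "diam n e p \<in> X" "e = d" using cd by (metis colour.exhaust)+
    show False
    proof (cases "p < u + n")
      case True
      then show False using p2[of u p c e] D b gap' s by auto
    next
      case False
      then show False using side_diam_wrap[of u s e p] s b e D by simp
    qed
  next
    fix p q assume b: "chord n p q \<in> X" "s < p" "p < s + n" "s + n < q" "q < s + 2 * n"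
    consider "q < u + 2 * n" "p < u + n" | "q < u + 2 * n" "p = u + n" | "q < u + 2 * n" "u + n < p"
      | "u + 2 * n \<le> q" by linarith
    then show False
    proof cases
      case 1
      then show False using diam_chord_cross[OF D(1) b(1)] gap'[of p] gap''[of q] b s by auto
    next
      case 2
      then show False using chord_mem_side[OF b(1)] gap''[of q] b s by auto
    next
      case 3
      have "side n X (u + n) (s + n)" using side_rot[of u s] s by simp
      then show False using side_chord_cross(2)[of "u + n" "s + n" p q] gap''[of q] b s 3 by auto
    next
      case 4
      then show False using side_chord_wrap[of u s p q] gap'[of p] b s by simp
    qed
  qed
qed

lemma greatest_side:
  assumes "u + 1 < v" "v \<le> u + n"
  obtains s where "u < s" "s < v" "side n X u s" "\<And>w. s < w \<Longrightarrow> w < v \<Longrightarrow> \<not> side n X u w"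
proof -
  let ?S = "{w. u < w \<and> w < v \<and> side n X u w}"
  have fin: "finite ?S" by (rule finite_subset[of _ "{..<v}"]) auto
  \<comment> \<open>Boundary edges count as sides, so there is always a candidate.\<close>
  have "side n X u (u + 1)" using n assms by (simp add: side_window)
  then have "?S \<noteq> {}" using assms by (auto intro!: exI[of _ "u + 1"])
  then have "Max ?S \<in> ?S" using Max_in fin by blast
  moreover have "w \<notin> ?S" if "Max ?S < w" for w
    using Max_ge[OF fin, of w] that by (meson not_less)
  ultimately obtain s where "s \<in> ?S" "\<And>w. s < w \<Longrightarrow> w \<notin> ?S" by blast
  then show thesis by (intro that[of s]) auto
qed

lemma no_diam_crossing:
  assumes D: "\<And>c. diam n c u \<notin> X"
    and s: "u < s" "s < u + n" "side n X u s"
    and gap: "\<And>w. s < w \<Longrightarrow> w < u + n \<Longrightarrow> \<not> side n X u w"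
  obtains t where "u + n < t" "t < u + 2 * n"
    "\<And>b. b \<in> arcs n \<Longrightarrow> endpoints b = {s mod (2 * n), t mod (2 * n)} \<Longrightarrow> b \<in> nc n X"
proof -
  define t where "t = (LEAST w. u + n < w \<and> side n X u w)"
  \<comment> \<open>The boundary edge ending at \<open>u\<close> ensures that \<open>t\<close>
    exists and lies before \<open>u + 2 * n\<close>.\<close>
  have "side n X u (u + 2 * n - 1)" using n by (subst side_window) auto
  then have ex: "u + n < u + 2 * n - 1 \<and> side n X u (u + 2 * n - 1)" using n by simp
  have t: "u + n < t" "side n X u t"
    using LeastI[of "\<lambda>w. u + n < w \<and> side n X u w", OF ex] unfolding t_def by auto
  have t2: "t < u + 2 * n"
    using Least_le[of "\<lambda>w. u + n < w \<and> side n X u w", OF ex] n unfolding t_def by linarith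
  have t3: "\<not> side n X u w" if "u + n < w" "w < t" for w
    using not_less_Least[of w "\<lambda>w. u + n < w \<and> side n X u w"] that unfolding t_def by auto
  have gap': "\<not> side n X u w" if "s < w" "w < t" for w
    using gap[of w] t3[of w] that D side_diam by (cases w "u + n" rule: linorder_cases) auto
  show thesis
  proof (rule that[OF t(1) t2])
    fix b assume b: "b \<in> arcs n" "endpoints b = {s mod (2 * n), t mod (2 * n)}"
    have "\<not> crosses b x" if "x \<in> X" for x
      using no_diam_not_separated[OF D s t(1) t2 t(2) gap' that] crosses_imp_separated[OF b(1) _ n0, of x]
        that X b(2) by auto
    then show "b \<in> nc n X" using b(1) by (simp add: nc_def)
  qed
qed

section \<open>Every arc outside \<open>X\<close> is crossed by an arc of
  \<open>nc n X\<close>\<close>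

lemma chord_not_mem_crossed:
  assumes uv: "u + 1 < v" "v < u + n" and "chord n u v \<notin> X"
  shows "\<exists>b \<in> nc n X. crosses (chord n u v) b"
proof -
  have v: "\<not> side n X u v" using assms side_mem_chord[of u v] by auto
  obtain s where s: "u < s" "s < v" "side n X u s" "\<And>w. s < w \<Longrightarrow> w < v \<Longrightarrow> \<not> side n X u w"
    using greatest_side[of u v] uv by auto
  show ?thesis
  proof (cases "\<exists>w. v < w \<and> w \<le> u + n \<and> side n X u w")
    case True
    define t where "t = (LEAST w. v < w \<and> side n X u w)"
    obtain w where w: "v < w \<and> side n X u w" "w \<le> u + n" using True by blast
    have t: "v < t" "side n X u t"
      using LeastI[of "\<lambda>w. v < w \<and> side n X u w", OF w(1)] unfolding t_def by auto
    have t2: "t \<le> u + n"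
      using Least_le[of "\<lambda>w. v < w \<and> side n X u w", OF w(1)] w unfolding t_def by linarith
    have t3: "\<not> side n X u w" if "v < w" "w < t" for w
      using not_less_Least[of w "\<lambda>w. v < w \<and> side n X u w"] that unfolding t_def by auto
    have gap: "\<not> side n X u w" if "s < w" "w < t" for w
      using s(4)[of w] t3[of w] v that by (cases w v rule: linorder_cases) auto
    have "chord n s t \<in> nc n X"
      using nc_consecutive[OF s(1,3) _ t2 t(2) gap] s(2) t(1) by simp
    moreover have "crosses (chord n u v) (chord n s t)"
      using s t t2 uv by (simp add: separatedI)
    ultimately show ?thesis by blast
  next
    case False
    have gap: "\<not> side n X u w" if "s < w" "w < u + n" for w
      using s(4)[of w] False v that by (cases w v rule: linorder_cases) auto
    have su: "s < u + n" using s uv by simp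
    show ?thesis
    proof (cases "\<exists>c. diam n c u \<in> X")
      case True
      then obtain c where c: "diam n c u \<in> X" by blast
      \<comment> \<open>Both colours at \<open>u\<close> would make \<open>u + n\<close> a joined
        vertex beyond \<open>v\<close>, so exactly one colour is present.\<close>
      have "\<not> side n X u (u + n)" using False uv by auto
      then obtain d where "diam n d u \<notin> X" using side_diam by blast
      then have "diam n c s \<in> nc n X" using one_diam_nc[OF c _ s(1) su s(3) gap] by blast
      moreover have "crosses (chord n u v) (diam n c s)"
        using s uv by (simp add: separatedI)
      ultimately show ?thesis by blast
    next
      case False
      then obtain t where t: "u + n < t" "t < u + 2 * n"
        "\<And>b. b \<in> arcs n \<Longrightarrow> endpoints b = {s mod (2 * n), t mod (2 * n)} \<Longrightarrow> b \<in> nc n X"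
        using no_diam_crossing[OF _ s(1) su s(3) gap] by blast
      \<comment> \<open>If \<open>{s, t}\<close> is a diameter, either colour serves, since a chord
        crosses diameters regardless of colour.\<close>
      define b where "b = (if t = s + n then diam n Green s else chord n s t)"
      have "b \<in> arcs n" "endpoints b = {s mod (2 * n), t mod (2 * n)}"
        using s t uv n0 by (auto simp: b_def diam_in_arcs intro!: chord_in_arcs)
      moreover have "separated {u mod (2 * n), v mod (2 * n)} {s mod (2 * n), t mod (2 * n)}"
        using s t uv by (simp add: separatedI)
      ultimately show ?thesis using t(3)[of b] by (intro bexI[of _ b]) simp_all
    qed
  qed
qed

lemma diam_not_mem_crossed:
  assumes u: "diam n c u \<notin> X"
  shows "\<exists>b \<in> nc n X. crosses (diam n c u) b"
proof -
  obtain s where s: "u < s" "s < u + n" "side n X u s" and gap: "\<And>w. s < w \<Longrightarrow> w < u + n \<Longrightarrow> \<not> side n X u w"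
    using greatest_side[of u "u + n"] n by auto
  show ?thesis
  proof (cases "\<exists>d. diam n d u \<in> X")
    case True
    then obtain d where d: "diam n d u \<in> X" by blast
    then have "diam n d s \<in> nc n X" using one_diam_nc[OF d u s gap] by blast
    moreover have "crosses (diam n c u) (diam n d s)"
      using s u d by (auto simp: crosses_diam)
    ultimately show ?thesis by blast
  next
    case False
    then obtain t where t: "u + n < t" "t < u + 2 * n"
      "\<And>b. b \<in> arcs n \<Longrightarrow> endpoints b = {s mod (2 * n), t mod (2 * n)} \<Longrightarrow> b \<in> nc n X"
      using no_diam_crossing[OF _ s gap] by blast
    \<comment> \<open>If \<open>{s, t}\<close> is a diameter, it has to take the other colour in
      order to cross the given one.\<close>
    obtain d where d: "d \<noteq> c" by (metis colour.distinct(1))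
    show ?thesis
    proof (cases "t = s + n")
      case True
      then have "diam n d s \<in> nc n X" using t(3)[of "diam n d s"] n0 by (simp add: diam_in_arcs)
      moreover have "crosses (diam n c u) (diam n d s)"
        using s d by (auto simp: crosses_diam)
      ultimately show ?thesis by blast
    next
      case False
      then have "chord n s t \<in> nc n X" using t s by (auto intro!: t(3) chord_in_arcs)
      moreover have "crosses (diam n c u) (chord n s t)"
        unfolding chord_def crosses_chord using s t by (simp add: separatedI)
      ultimately show ?thesis by blast
    qed
  qed
qed

lemma nc_nc_eq: "nc n (nc n X) = X"
proof
  show "X \<subseteq> nc n (nc n X)"
    using X by (auto simp: nc_def crosses_commute)
  show "nc n (nc n X) \<subseteq> X"
  proof
    fix a assume a: "a \<in> nc n (nc n X)"
    then have "a \<in> arcs n" by (simp add: nc_def)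
    then show "a \<in> X" using n0
    proof (cases rule: arcs_cases)
      case (chord x y)
      then show ?thesis using chord_not_mem_crossed a nc_no_cross by blast
    next
      case (diam c x)
      then show ?thesis using diam_not_mem_crossed a nc_no_cross by blast
    qed
  qed
qed

end

section \<open>The \<open>2\<close>-gon and the equivalence\<close>

lemma arcs_1: "arcs 1 = {Diameter Green {0, 1}, Diameter Red {0, 1}}"
proof -
  have 1: "diameter 1 c i = Diameter c {0, 1}" if "i < 2" for c i
    using that by (auto simp: diameter_def opposite_def less_2_cases_iff)
  have "neighbours 1 i j" if "i < 2" "j < 2" "i \<noteq> j" for i j
    using that by (auto simp: neighbours_def less_2_cases_iff)
  then have "arcs 1 = {diameter 1 c i | c i. i < 2}"
    unfolding arcs_def by auto
  also have "\<dots> = range (\<lambda>c. Diameter c {0, 1})"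
    using 1 by (auto intro!: exI[of _ 0])
  also have "\<dots> = {Diameter Green {0, 1}, Diameter Red {0, 1}}"
    by (auto intro: colour.exhaust)
  finally show ?thesis .
qed

text \<open>The only two arcs share their endpoints and hence do not cross.\<close>

lemma nc_1: "Y \<subseteq> arcs 1 \<Longrightarrow> nc 1 Y = arcs 1"
  unfolding nc_def arcs_1 by auto

theorem theorem4p2:
  fixes n :: nat and X :: "arc set"
  assumes "n \<ge> 1"
    and "X \<subseteq> arcs n"
    and "rot180 n ` X = X"
  shows "X = nc n (nc n X) \<longleftrightarrow> ptolemy_diagram_D n X"
proof (cases "n = 1")
  case True
  have "nc 1 X = arcs 1" using nc_1 assms True by simp
  then have "nc n (nc n X) = {Diameter Green {0, 1}, Diameter Red {0, 1}}"
    using nc_1 arcs_1 True by simp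
  then show ?thesis using True by (simp add: ptolemy_diagram_D_def)
next
  case False
  then have n: "1 < n" "0 < n" using assms(1) by simp_all
  show ?thesis
  proof
    assume eq: "X = nc n (nc n X)"
    have "nc n X \<subseteq> arcs n" by (auto simp: nc_def)
    \<comment> \<open>By \<open>eq\<close>, \<open>X\<close> is \<open>nc n Y\<close> for the
      rotation-invariant set \<open>Y = nc n X\<close>.\<close>
    note nc_X = n(2) this rot180_nc[OF n(2) assms(2,3)]
    note Pts = Pt1_nc[OF nc_X] Pt2_nc[OF nc_X] Pt3_nc[OF nc_X]
    show "ptolemy_diagram_D n X"
      using Pts False assms(2,3) unfolding eq[symmetric] by (simp add: ptolemy_diagram_D_def)
  next
    assume "ptolemy_diagram_D n X"
    then interpret ptolemy n X
      using False n assms(2,3) by unfold_locales (simp_all add: ptolemy_diagram_D_def)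
    show "X = nc n (nc n X)" using nc_nc_eq by simp
  qed
qed

end
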